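(* Let $\mathcal{H}$ be a complex Hilbert space, let $B\in\mathcal{B}(\mathcal{H})$, and let $T=\begin{pmatrix} I & B\\ 0 & 0\end{pmatrix}\in\mathcal{B}(\mathcal{H}\oplus\mathcal{H})$. If $B=0$, then $dw(T)=\sqrt{2}$. If $B\neq 0$, then $$dw(T)=\left(\cos\theta_0+\|B\|\sin\theta_0\right)\left(\cos^2\theta_0+(\cos\theta_0+\|B\|\sin\theta_0)^2\right)^{\frac{1}{2}},$$ where $b=\|B\|$, $p=-\frac{2b^2-5}{2b}$, $q=-\frac{2b^2-2}{b^2}$, $r=-\frac{3}{2b}$, $s=\frac{1}{2^4 3^3 b^6}\left(8b^8+20b^6+45b^4+61b^2+28\right)$, $\alpha=\frac{1}{27}\left(2p^3-9pq+27r\right)$, $\beta=\left(-\frac{\alpha}{2}+\sqrt{s}\right)^{\frac{1}{3}}$, $\gamma=\left(-\frac{\alpha}{2}-\sqrt{s}\right)^{\frac{1}{3}}$ and $\theta_0=\tan^{-1}\left(\beta+\gamma-\frac{p}{3}\right)$.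
   Context: $\mathcal{B}(\mathcal{H})$ is the algebra of bounded linear operators on the complex Hilbert space $\mathcal{H}$, with operator norm $\|\cdot\|$; $I$ and $0$ are the identity and zero operators. A $2\times2$ operator matrix acts on the Hilbert space direct sum $\mathcal{H}\oplus\mathcal{H}$ (norm $\|(x,y)\|^2=\|x\|^2+\|y\|^2$) in the usual way. For a bounded operator $T$ on a complex Hilbert space, the Davis-Wielandt radius is $dw(T)=\sup\{\sqrt{|\langle Tz,z\rangle|^2+\|Tz\|^4}: \|z\|=1\}$. The cube roots defining $\beta,\gamma$ are real cube roots of real numbers (with $(-a)^{1/3}=-a^{1/3}$ for $a\ge 0$). *)

theory Defs
  imports "HOL-Analysis.Analysis"
begin

class scaleC =
  fixes scaleC :: "complex \<Rightarrow> 'a \<Rightarrow> 'a" (infixr "*\<^sub>C" 75)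

class complex_vector = real_vector + scaleC +
  assumes scaleC_add_right: "c *\<^sub>C (x + y) = c *\<^sub>C x + c *\<^sub>C y"
    and scaleC_add_left: "(c + d) *\<^sub>C x = c *\<^sub>C x + d *\<^sub>C x"
    and scaleC_scaleC: "c *\<^sub>C d *\<^sub>C x = (c * d) *\<^sub>C x"
    and scaleC_of_real: "complex_of_real a *\<^sub>C x = a *\<^sub>R x"

text \<open>The inner product is linear in its first argument. Positive definiteness is contained in
  \<open>cinner_self\<close>, because the norm of a real normed vector space vanishes only at zero.\<close>

class complex_inner = complex_vector + real_normed_vector +
  fixes cinner :: "'a \<Rightarrow> 'a \<Rightarrow> complex"
  assumes cinner_commute: "cinner x y = cnj (cinner y x)"
    and cinner_add_left: "cinner (x + y) z = cinner x z + cinner y z"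
    and cinner_scaleC_left: "cinner (c *\<^sub>C x) y = c * cinner x y"
    and cinner_self: "cinner x x = complex_of_real ((norm x)\<^sup>2)"

class chilbert_space = complex_inner + complete_space

subclass (in chilbert_space) banach ..

instantiation complex :: chilbert_space
begin

definition scaleC_complex :: "complex \<Rightarrow> complex \<Rightarrow> complex"
  where "scaleC_complex c x = c * x"

definition cinner_complex :: "complex \<Rightarrow> complex \<Rightarrow> complex"
  where "cinner_complex x y = x * cnj y"

instance
  by standard
    (simp_all add: scaleC_complex_def cinner_complex_def algebra_simps scaleR_conv_of_real
      complex_norm_square del: of_real_power)

end

text \<open>The Hilbert space direct sum is the product type: the library norm on it is
  \<open>norm (x, y) = sqrt ((norm x)\<^sup>2 + (norm y)\<^sup>2)\<close>.\<close>

instantiation prod :: (complex_vector, complex_vector) complex_vector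
begin

definition scaleC_prod :: "complex \<Rightarrow> 'a \<times> 'b \<Rightarrow> 'a \<times> 'b"
  where "scaleC_prod c z = (c *\<^sub>C fst z, c *\<^sub>C snd z)"

instance
  by standard
    (simp_all add: scaleC_prod_def scaleC_add_right scaleC_add_left scaleC_scaleC
      scaleC_of_real scaleR_prod_def)

end

instantiation prod :: (complex_inner, complex_inner) complex_inner
begin

definition cinner_prod :: "'a \<times> 'b \<Rightarrow> 'a \<times> 'b \<Rightarrow> complex"
  where "cinner_prod z w = cinner (fst z) (fst w) + cinner (snd z) (snd w)"

instance
proof
  fix x y z :: "'a \<times> 'b" and c :: complex
  show "cinner x y = cnj (cinner y x)"
    unfolding cinner_prod_def
    by (metis cinner_commute complex_cnj_add)
  show "cinner (x + y) z = cinner x z + cinner y z"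
    by (simp add: cinner_prod_def cinner_add_left)
  show "cinner (c *\<^sub>C x) y = c * cinner x y"
    by (simp add: cinner_prod_def scaleC_prod_def cinner_scaleC_left distrib_left)
  show "cinner x x = complex_of_real ((norm x)\<^sup>2)"
    by (simp add: cinner_prod_def cinner_self norm_prod_def)
qed

end

instance prod :: (chilbert_space, chilbert_space) chilbert_space ..

definition bounded_clinear :: "('a::complex_inner \<Rightarrow> 'b::complex_inner) \<Rightarrow> bool"
  where "bounded_clinear A \<longleftrightarrow> bounded_linear A \<and> (\<forall>c x. A (c *\<^sub>C x) = c *\<^sub>C A x)"

definition op_matrix ::
    "('a \<Rightarrow> 'a) \<Rightarrow> ('a \<Rightarrow> 'a) \<Rightarrow> ('a \<Rightarrow> 'a) \<Rightarrow> ('a \<Rightarrow> 'a) \<Rightarrow> 'a \<times> 'a \<Rightarrow> ('a::complex_inner) \<times> 'a"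
  where "op_matrix A B C D = (\<lambda>(x, y). (A x + B y, C x + D y))"

lemma bounded_clinear_op_matrix:
  fixes A B C D :: "'a::complex_inner \<Rightarrow> 'a"
  assumes "bounded_clinear A" "bounded_clinear B" "bounded_clinear C" "bounded_clinear D"
  shows "bounded_clinear (op_matrix A B C D)"
proof -
  have "bounded_linear (\<lambda>z. f (fst z :: 'a) + g (snd z :: 'a))"
    if "bounded_clinear f" "bounded_clinear g" for f g :: "'a \<Rightarrow> 'a"
    using that unfolding bounded_clinear_def
    by (metis bounded_linear_add bounded_linear_compose bounded_linear_fst bounded_linear_snd)
  then have "bounded_linear (\<lambda>z. (A (fst z) + B (snd z), C (fst z) + D (snd z)))"
    using assms by (intro bounded_linear_Pair) blast+
  then show ?thesis
    using assms
    by (auto simp: bounded_clinear_def op_matrix_def case_prod_unfold scaleC_prod_def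
        scaleC_add_right)
qed

text \<open>The supremum is taken in the reals, so it is meaningful only for a bounded operator on a
  nonzero space; the value on the zero space is arbitrary.\<close>

definition dw :: "('a::complex_inner \<Rightarrow> 'a) \<Rightarrow> real"
  where "dw T = (SUP z\<in>{z. norm z = 1}. sqrt ((cmod (cinner (T z) z))\<^sup>2 + norm (T z) ^ 4))"

end

theory Submission
  imports Defs
begin

text \<open>For a unit vector \<open>(x, y)\<close> with \<open>\<parallel>x\<parallel> = cos \<theta>\<close> and \<open>\<parallel>y\<parallel> = sin \<theta>\<close>, Cauchy-Schwarz bounds the quantity
  in the supremum by \<open>w sqrt (cos\<^sup>2 \<theta> + w\<^sup>2)\<close> with \<open>w = cos \<theta> + b sin \<theta>\<close>, and the bound is approached by
  almost norm-attaining \<open>y\<close> with \<open>x\<close> parallel to \<open>B y\<close>. The square of this function has derivative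
  \<open>- 4 b\<^sup>2 w cos\<^sup>3 \<theta> P (tan \<theta>)\<close>, where \<open>P t = t\<^sup>3 + p t\<^sup>2 + q t + r\<close>. Cardano's formula gives a real
  root of \<open>P\<close> whose cofactor is nonnegative, hence the function increases up to \<open>\<theta>\<^sub>0\<close> and
  decreases afterwards.\<close>

section \<open>Inner product rules and the Cauchy-Schwarz inequality\<close>

lemma cinner_add_right:
  "cinner x (y + z) = cinner x y + cinner (x::'a::complex_inner) z"
  by (metis cinner_commute cinner_add_left complex_cnj_add)

lemma cinner_scaleC_right:
  "cinner x (c *\<^sub>C y) = cnj c * cinner (x::'a::complex_inner) y"
  by (metis cinner_commute cinner_scaleC_left complex_cnj_mult)

lemma cinner_zero_left: "cinner 0 (y::'a::complex_inner) = 0"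
  using cinner_add_left[of 0 0 y] by simp

lemma cinner_scaleR_left:
  "cinner (a *\<^sub>R x) y = of_real a * cinner (x::'a::complex_inner) y"
  by (metis cinner_scaleC_left scaleC_of_real)

lemma cinner_scaleR_right:
  "cinner x (a *\<^sub>R y) = of_real a * cinner (x::'a::complex_inner) y"
  by (metis cinner_scaleC_right scaleC_of_real complex_cnj_complex_of_real)

lemma cmod_cinner_le: "cmod (cinner x y) \<le> norm x * norm (y::'a::complex_inner)"
proof (cases "y = 0")
  case True
  then show ?thesis
    using cinner_scaleR_right[of x 0 y] by simp
next
  case False
  define c where "c = cinner x y"
  define n where "n = (norm y)\<^sup>2"
  \<comment> \<open>This coefficient makes \<open>x + d y\<close> the component of \<open>x\<close>
    orthogonal to \<open>y\<close>; the inequality says that its squared norm is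
    nonnegative.\<close>
  define d where "d = - c / of_real n"
  have n: "n > 0" using False by (simp add: n_def)
  have "complex_of_real ((norm (x + d *\<^sub>C y))\<^sup>2)
      = of_real ((norm x)\<^sup>2) + cnj d * c + d * cnj c + d * cnj d * of_real n"
    unfolding cinner_self[symmetric] c_def n_def
    by (simp add: cinner_add_left cinner_add_right cinner_scaleC_left cinner_scaleC_right
        cinner_commute[of y x] algebra_simps)
  also have "\<dots> = of_real ((norm x)\<^sup>2 - (cmod c)\<^sup>2 / n)"
    using n by (simp add: d_def complex_norm_square field_simps del: of_real_power)
  finally have "(norm (x + d *\<^sub>C y))\<^sup>2 = (norm x)\<^sup>2 - (cmod c)\<^sup>2 / n"
    using of_real_eq_iff by blast
  then have "(cmod c)\<^sup>2 / n \<le> (norm x)\<^sup>2"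
    by (metis diff_ge_0_iff_ge zero_le_power2)
  then have "(cmod c)\<^sup>2 \<le> (norm x * norm y)\<^sup>2"
    using n by (simp add: field_simps n_def power_mult_distrib)
  then show ?thesis
    unfolding c_def by (rule power2_le_imp_le) simp
qed

section \<open>Reduction of the supremum to a maximum over one angle\<close>

lemma dw_integrand_le:
  fixes T :: "'a::complex_inner \<Rightarrow> 'a"
  assumes "norm (T z) \<le> w" and "cmod (cinner (T z) z) \<le> c * w"
  shows "sqrt ((cmod (cinner (T z) z))\<^sup>2 + norm (T z) ^ 4) \<le> w * sqrt (c\<^sup>2 + w\<^sup>2)"
proof -
  have w: "w \<ge> 0" using assms(1) norm_ge_zero order_trans by blast
  have "(cmod (cinner (T z) z))\<^sup>2 + norm (T z) ^ 4 \<le> (c * w)\<^sup>2 + w ^ 4"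
    using assms by (intro add_mono power_mono) auto
  also have "\<dots> = w\<^sup>2 * (c\<^sup>2 + w\<^sup>2)"
    by algebra
  finally show ?thesis
    using w real_sqrt_le_mono by (fastforce simp: real_sqrt_mult)
qed

text \<open>This is the quantity under the supremum at the unit vector
  \<open>(cos \<theta> e, sin \<theta> y)\<close> when \<open>e\<close>, \<open>y\<close> are unit
  vectors, \<open>B y = b e\<close>, \<open>b\<close> is nonnegative and the angle lies in the first
  quadrant. The parameter \<open>b\<close> is kept free because the lower bound uses values below
  the operator norm.\<close>

definition dw_profile :: "real \<Rightarrow> real \<Rightarrow> real"
  where "dw_profile b \<theta> =
    (cos \<theta> + b * sin \<theta>) * sqrt ((cos \<theta>)\<^sup>2 + (cos \<theta> + b * sin \<theta>)\<^sup>2)"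

text \<open>The bound is stated for each unit vector and not for \<open>dw\<close>, since it serves
  twice: to estimate the supremum from above, and to show that the set of values is bounded above at
  all.\<close>

lemma dw_op_matrix_bound:
  fixes B :: "'a::complex_inner \<Rightarrow> 'a"
  assumes B: "bounded_clinear B"
    and M: "\<And>\<theta>. 0 \<le> \<theta> \<Longrightarrow> \<theta> \<le> pi / 2 \<Longrightarrow> dw_profile (onorm B) \<theta> \<le> M"
    and z: "norm z = 1"
  defines "T \<equiv> op_matrix (\<lambda>x. x) B (\<lambda>x. 0) (\<lambda>x. 0)"
  shows "sqrt ((cmod (cinner (T z) z))\<^sup>2 + norm (T z) ^ 4) \<le> M"
proof -
  obtain x y where xy: "z = (x, y)" by (cases z)
  have bl: "bounded_linear B" using B by (simp add: bounded_clinear_def)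
  have 1: "(norm x)\<^sup>2 + (norm y)\<^sup>2 = 1"
    using z by (simp add: xy norm_prod_def)
  \<comment> \<open>The norms of the two components form a point of the unit circle in the closed
    first quadrant, so they are the cosine and sine of this angle.\<close>
  define \<theta> where "\<theta> = arccos (norm x)"
  have x1: "norm x \<le> 1"
    using 1 by (metis le_add_same_cancel1 power2_le_imp_le zero_le_one zero_le_power2 power_one)
  have x0: "- 1 \<le> norm x" by (rule order_trans[OF _ norm_ge_zero]) simp
  have c: "cos \<theta> = norm x" and th: "0 \<le> \<theta>" "\<theta> \<le> pi / 2"
    unfolding \<theta>_def using x0 x1 cos_arccos arccos_lbound arccos_le_pi2[OF norm_ge_zero] by blast+
  have s: "sin \<theta> = norm y"
  proof (rule power2_eq_imp_eq)
    show "(sin \<theta>)\<^sup>2 = (norm y)\<^sup>2" using 1 by (simp add: sin_squared_eq c)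
    show "0 \<le> sin \<theta>" using th by (intro sin_ge_zero) auto
  qed simp
  have Tz: "T z = (x + B y, 0)" by (simp add: T_def xy op_matrix_def)
  have w: "norm (x + B y) \<le> cos \<theta> + onorm B * sin \<theta>"
    unfolding c s by (rule norm_triangle_le) (simp add: onorm[OF bl])
  have "cmod (cinner (T z) z) \<le> norm (x + B y) * norm x"
    unfolding Tz by (simp add: xy cinner_prod_def cinner_zero_left cmod_cinner_le)
  also have "\<dots> \<le> cos \<theta> * (cos \<theta> + onorm B * sin \<theta>)"
    unfolding c using w by (simp add: c mult.commute mult_left_mono)
  finally have "sqrt ((cmod (cinner (T z) z))\<^sup>2 + norm (T z) ^ 4) \<le> dw_profile (onorm B) \<theta>"
    unfolding dw_profile_def using w by (intro dw_integrand_le) (simp_all add: Tz norm_Pair)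
  then show ?thesis
    using M[OF th] by linarith
qed

lemma dw_op_matrix_le:
  fixes B :: "'a::complex_inner \<Rightarrow> 'a"
  assumes nontrivial: "(UNIV :: 'a set) \<noteq> {0}"
    and B: "bounded_clinear B"
    and M: "\<And>\<theta>. 0 \<le> \<theta> \<Longrightarrow> \<theta> \<le> pi / 2 \<Longrightarrow> dw_profile (onorm B) \<theta> \<le> M"
  shows "dw (op_matrix (\<lambda>x. x) B (\<lambda>x. 0) (\<lambda>x. 0)) \<le> M"
  unfolding dw_def
proof (rule cSUP_least)
  \<comment> \<open>\<open>cSUP_least\<close> requires a nonempty index set, hence a unit vector
    must be exhibited.\<close>
  obtain x :: 'a where "x \<noteq> 0" using nontrivial by blast
  then have "norm (sgn x, 0::'a) = 1" by (simp add: norm_Pair norm_sgn)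
  then show "{z :: 'a \<times> 'a. norm z = 1} \<noteq> {}" by blast
qed (use dw_op_matrix_bound[OF B M] in auto)

text \<open>Since \<open>B y\<close> is a nonnegative multiple of \<open>e\<close>, both the
  triangle inequality and Cauchy-Schwarz are equalities at the test vector \<open>z\<close>. The
  bound \<open>M\<close> supplies the boundedness above that a real supremum needs in order to
  dominate its members.\<close>

lemma dw_profile_le_dw:
  fixes B :: "'a::complex_inner \<Rightarrow> 'a"
  assumes B: "bounded_clinear B"
    and bdd: "\<And>\<theta>. 0 \<le> \<theta> \<Longrightarrow> \<theta> \<le> pi / 2 \<Longrightarrow> dw_profile (onorm B) \<theta> \<le> M"
    and unit: "norm e = 1" "norm y = 1"
    and By: "B y = k *\<^sub>R e" "0 \<le> k"
    and th: "0 \<le> \<theta>" "\<theta> \<le> pi / 2"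
  shows "dw_profile k \<theta> \<le> dw (op_matrix (\<lambda>x. x) B (\<lambda>x. 0) (\<lambda>x. 0))"
proof -
  define T where "T = op_matrix (\<lambda>x. x) B (\<lambda>x. 0) (\<lambda>x. 0)"
  define z where "z = (cos \<theta> *\<^sub>R e, sin \<theta> *\<^sub>R y)"
  define w where "w = cos \<theta> + k * sin \<theta>"
  have cs: "0 \<le> cos \<theta>" "0 \<le> sin \<theta>"
    using th by (auto intro!: cos_ge_zero sin_ge_zero)
  have w: "0 \<le> w" using cs By by (simp add: w_def)
  have z1: "norm z = 1"
    using unit by (simp add: z_def norm_Pair)
  have "B (sin \<theta> *\<^sub>R y) = sin \<theta> *\<^sub>R B y"
    using B by (simp add: bounded_clinear_def linear_simps)
  then have Tz: "T z = (w *\<^sub>R e, 0)"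
    by (simp add: T_def z_def op_matrix_def By w_def scaleR_add_left mult.commute)
  have nT: "norm (T z) = w"
    using w unit by (simp add: Tz norm_Pair)
  have "cinner (T z) z = of_real (cos \<theta> * w)"
    unfolding Tz by (simp add: z_def cinner_prod_def cinner_zero_left cinner_scaleR_left
        cinner_scaleR_right cinner_self unit mult.commute)
  then have "(cmod (cinner (T z) z))\<^sup>2 + norm (T z) ^ 4 = w\<^sup>2 * ((cos \<theta>)\<^sup>2 + w\<^sup>2)"
    unfolding nT by (simp add: norm_mult power_mult_distrib distrib_left mult.commute flip: power_add)
  then have "dw_profile k \<theta> = sqrt ((cmod (cinner (T z) z))\<^sup>2 + norm (T z) ^ 4)"
    using w by (simp add: dw_profile_def w_def[symmetric] real_sqrt_mult)
  also have "\<dots> \<le> dw T"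
    unfolding dw_def
  proof (rule cSUP_upper)
    show "bdd_above ((\<lambda>z. sqrt ((cmod (cinner (T z) z))\<^sup>2 + norm (T z) ^ 4)) ` {z. norm z = 1})"
      using dw_op_matrix_bound[OF B bdd] unfolding T_def by (auto intro!: bdd_aboveI2)
  qed (simp add: z1)
  finally show ?thesis unfolding T_def .
qed

text \<open>The operator norm need not be attained. The lower bound is therefore proved for every
  positive \<open>k < onorm B\<close> and passed to the limit with the angle fixed. When the norm is
  zero there is no such \<open>k\<close>, and any unit vector serves as both \<open>e\<close> and
  \<open>y\<close>.\<close>

lemma dw_op_matrix_eq:
  fixes B :: "'a::complex_inner \<Rightarrow> 'a"
  assumes nontrivial: "(UNIV :: 'a set) \<noteq> {0}"
    and B: "bounded_clinear B"
    and th: "0 \<le> \<theta>" "\<theta> \<le> pi / 2"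
    and max: "\<And>\<phi>. 0 \<le> \<phi> \<Longrightarrow> \<phi> \<le> pi / 2 \<Longrightarrow> dw_profile (onorm B) \<phi> \<le> dw_profile (onorm B) \<theta>"
  shows "dw (op_matrix (\<lambda>x. x) B (\<lambda>x. 0) (\<lambda>x. 0)) = dw_profile (onorm B) \<theta>"
proof (rule antisym)
  let ?D = "dw (op_matrix (\<lambda>x. x) B (\<lambda>x. 0) (\<lambda>x. 0))"
  show "?D \<le> dw_profile (onorm B) \<theta>"
    using nontrivial B max by (rule dw_op_matrix_le)
  have bl: "bounded_linear B" using B by (simp add: bounded_clinear_def)
  show "dw_profile (onorm B) \<theta> \<le> ?D"
  proof (cases "onorm B = 0")
    case True
    obtain x :: 'a where "x \<noteq> 0" using nontrivial by blast
    then have "norm (sgn x) = 1" by (simp add: norm_sgn)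
    moreover have "B (sgn x) = 0 *\<^sub>R sgn x"
      using True onorm_eq_0[OF bl] by simp
    ultimately have "dw_profile 0 \<theta> \<le> ?D"
      using dw_profile_le_dw[OF B max] th by blast
    then show ?thesis by (simp add: True)
  next
    case False
    then have b: "0 < onorm B" using onorm_pos_le[OF bl] by simp
    have *: "dw_profile k \<theta> \<le> ?D" if k: "0 < k" "k < onorm B" for k
    proof -
      have "\<not> (\<forall>x. norm (B x) \<le> k * norm x)"
        using onorm_bound[of k B] k by auto
      then obtain x where x: "k * norm x < norm (B x)" by (auto simp: not_le)
      then have "x \<noteq> 0" using bl by (auto simp: linear_simps)
      define y where "y = sgn x"
      have y: "norm y = 1" using \<open>x \<noteq> 0\<close> by (simp add: y_def norm_sgn)
      have "norm (B y) = norm (B x) / norm x"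
        using bl by (simp add: y_def sgn_div_norm linear_simps divide_inverse mult.commute)
      then have ky: "k < norm (B y)"
        using x \<open>x \<noteq> 0\<close> by (simp add: pos_less_divide_eq)
      \<comment> \<open>Positivity of \<open>k\<close> guarantees that \<open>B y\<close> has a
        direction, which becomes the unit vector \<open>e\<close>.\<close>
      then have "B y \<noteq> 0" using k by auto
      then have "norm (sgn (B y)) = 1" "B y = norm (B y) *\<^sub>R sgn (B y)"
        by (simp_all add: norm_sgn sgn_div_norm)
      then have "dw_profile (norm (B y)) \<theta> \<le> ?D"
        using dw_profile_le_dw[OF B max] y th norm_ge_zero by blast
      moreover have "dw_profile k \<theta> \<le> dw_profile (norm (B y)) \<theta>"
      proof -
        have "0 \<le> cos \<theta>" "0 \<le> sin \<theta>"
          using th by (auto intro!: cos_ge_zero sin_ge_zero)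
        then show ?thesis
          unfolding dw_profile_def using k ky
          by (intro mult_mono add_mono real_sqrt_le_mono power_mono mult_right_mono) auto
      qed
      ultimately show ?thesis by linarith
    qed
    \<comment> \<open>The profile is continuous in its first parameter, so the bound survives
      letting \<open>k\<close> tend to the norm from below.\<close>
    have "((\<lambda>k. dw_profile k \<theta>) \<longlongrightarrow> dw_profile (onorm B) \<theta>) (at_left (onorm B))"
      unfolding dw_profile_def by (intro tendsto_intros)
    moreover have "eventually (\<lambda>k. dw_profile k \<theta> \<le> ?D) (at_left (onorm B))"
      using eventually_at_left_real[OF b] by eventually_elim (use * in auto)
    ultimately show ?thesis
      by (rule tendsto_upperbound) simp
  qed
qed

section \<open>Cardano's formula with a sign-definite cofactor\<close>

text \<open>With \<open>y = t + p / 3\<close> the cubic becomes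
  \<open>y^3 + (q - p^2 / 3) y + \<alpha>\<close>. The cube roots satisfy
  \<open>3 \<beta> \<gamma> = - (q - p^2 / 3)\<close> and
  \<open>\<beta>^3 + \<gamma>^3 = - \<alpha>\<close>, so it equals
  \<open>y^3 - \<beta>^3 - \<gamma>^3 - 3 y \<beta> \<gamma>\<close>, which is divisible by
  \<open>y - \<beta> - \<gamma>\<close>.\<close>

lemma cardano_factorization:
  fixes p q r s :: real
  defines "\<alpha> \<equiv> (2 * p ^ 3 - 9 * p * q + 27 * r) / 27"
  defines "\<beta> \<equiv> root 3 (- \<alpha> / 2 + sqrt s)" and "\<gamma> \<equiv> root 3 (- \<alpha> / 2 - sqrt s)"
  assumes s: "s = \<alpha>\<^sup>2 / 4 + (q - p\<^sup>2 / 3) ^ 3 / 27" and s0: "0 \<le> s"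
  obtains Q where "\<And>t. 0 \<le> Q t"
    and "\<And>t. t ^ 3 + p * t\<^sup>2 + q * t + r = (t - (\<beta> + \<gamma> - p / 3)) * Q t"
proof
  let ?y = "\<lambda>t. t + p / 3"
  \<comment> \<open>The cofactor \<open>y^2 + (\<beta> + \<gamma>) y + \<beta>^2 - \<beta> \<gamma>
    + \<gamma>^2\<close> with the square completed.\<close>
  let ?Q = "\<lambda>t. (?y t + (\<beta> + \<gamma>) / 2)\<^sup>2 + 3 / 4 * (\<beta> - \<gamma>)\<^sup>2"
  show "0 \<le> ?Q t" for t by simp
  have b3: "\<beta> ^ 3 = - \<alpha> / 2 + sqrt s" and g3: "\<gamma> ^ 3 = - \<alpha> / 2 - sqrt s"
    by (simp_all add: \<beta>_def \<gamma>_def odd_real_root_pow)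
  have "(- \<alpha> / 2 + sqrt s) * (- \<alpha> / 2 - sqrt s) = \<alpha>\<^sup>2 / 4 - (sqrt s)\<^sup>2"
    by (simp add: algebra_simps power2_eq_square)
  also have "\<dots> = (- (q - p\<^sup>2 / 3) / 3) ^ 3"
    unfolding real_sqrt_pow2[OF s0] by (subst s) (simp add: power_divide del: minus_diff_eq)
  finally have "(- \<alpha> / 2 + sqrt s) * (- \<alpha> / 2 - sqrt s) = (- (q - p\<^sup>2 / 3) / 3) ^ 3" .
  \<comment> \<open>The real cube root is multiplicative, so \<open>\<beta> \<gamma>\<close> is the
    cube root of the product just shown to be a cube.\<close>
  moreover have "root 3 (x ^ 3) = x" for x :: real
    by (simp add: odd_real_root_power_cancel)
  ultimately have bg: "\<beta> * \<gamma> = - (q - p\<^sup>2 / 3) / 3"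
    unfolding \<beta>_def \<gamma>_def real_root_mult[symmetric] by simp
  have "(t - (\<beta> + \<gamma> - p / 3)) * ?Q t = (?y t) ^ 3 - 3 * (\<beta> * \<gamma>) * ?y t - (\<beta> ^ 3 + \<gamma> ^ 3)" for t
    by (simp add: field_simps power2_eq_square power3_eq_cube)
  also have "\<dots> t = t ^ 3 + p * t\<^sup>2 + q * t + r" for t
    unfolding bg b3 g3 \<alpha>_def by (simp add: field_simps power2_eq_square power3_eq_cube)
  finally show "t ^ 3 + p * t\<^sup>2 + q * t + r = (t - (\<beta> + \<gamma> - p / 3)) * ?Q t" for t
    by simp
qed

section \<open>Maximisation of the profile over the first quadrant\<close>

text \<open>Squaring removes the square root, and a nonzero cosine allows everything to be written
  in the tangent; the cubic of the theorem appears as a factor of the derivative.\<close>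

lemma dw_profile_sq_deriv:
  fixes b \<theta> :: real
  assumes "b \<noteq> 0" "cos \<theta> \<noteq> 0"
  defines "w \<equiv> cos \<theta> + b * sin \<theta>"
  shows "((\<lambda>\<theta>. (dw_profile b \<theta>)\<^sup>2) has_real_derivative
    - 4 * b\<^sup>2 * w * cos \<theta> ^ 3 *
      (tan \<theta> ^ 3 + (- ((2 * b\<^sup>2 - 5) / (2 * b))) * (tan \<theta>)\<^sup>2 +
       (- ((2 * b\<^sup>2 - 2) / b\<^sup>2)) * tan \<theta> + (- (3 / (2 * b))))) (at \<theta>)"
proof -
  define c t where "c = cos \<theta>" and "t = tan \<theta>"
  have sin: "sin \<theta> = c * t" and c: "c \<noteq> 0"
    using assms by (simp_all add: c_def t_def tan_def)
  have one: "c\<^sup>2 * (1 + t\<^sup>2) = 1"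
    using sin_cos_squared_add[of \<theta>] by (simp add: sin c_def[symmetric] algebra_simps power_mult_distrib)
  have sq: "(dw_profile b \<theta>)\<^sup>2 =
      (cos \<theta> + b * sin \<theta>)\<^sup>2 * ((cos \<theta>)\<^sup>2 + (cos \<theta> + b * sin \<theta>)\<^sup>2)" for \<theta>
    by (simp add: dw_profile_def power_mult_distrib)
  have "((\<lambda>\<theta>. (dw_profile b \<theta>)\<^sup>2) has_real_derivative
     2 * w * ((b * c - c * t) * (c\<^sup>2 + 2 * w\<^sup>2) - c * (c * t) * w)) (at \<theta>)"
    unfolding sq
    by (rule derivative_eq_intros refl)+ (simp add: w_def sin c_def[symmetric] power2_eq_square algebra_simps)
  \<comment> \<open>Here \<open>w = c (1 + b t)\<close>. After cancelling \<open>2 w c^3\<close> the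
    claim is \<open>(b - t) (1 + 2 (1 + b t)^2) - t (1 + b t) = - 2 b^2 P t\<close>, an identity of
    polynomials in \<open>t\<close>.\<close>
  moreover have "2 * w * ((b * c - c * t) * (c\<^sup>2 + 2 * w\<^sup>2) - c * (c * t) * w)
      = - 4 * b\<^sup>2 * w * c ^ 3 * (t ^ 3 + (- ((2 * b\<^sup>2 - 5) / (2 * b))) * t\<^sup>2 +
       (- ((2 * b\<^sup>2 - 2) / b\<^sup>2)) * t + (- (3 / (2 * b))))"
    unfolding w_def sin c_def[symmetric] using assms(1)
    by (simp add: field_simps power2_eq_square power3_eq_cube)
  ultimately show ?thesis
    unfolding c_def t_def by simp
qed

text \<open>On the open quadrant the derivative of the squared profile is a nonnegative factor times
  \<open>t\<^sub>0 - tan x\<close>, so its sign changes at most once, at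
  \<open>arctan t\<^sub>0\<close>.\<close>

lemma dw_profile_max:
  fixes b t\<^sub>0 :: real and Q :: "real \<Rightarrow> real"
  assumes b: "0 < b" and Q: "\<And>t. 0 \<le> Q t"
    and fact: "\<And>t. t ^ 3 + (- ((2 * b\<^sup>2 - 5) / (2 * b))) * t\<^sup>2 +
       (- ((2 * b\<^sup>2 - 2) / b\<^sup>2)) * t + (- (3 / (2 * b))) = (t - t\<^sub>0) * Q t"
  shows "0 \<le> t\<^sub>0"
    and "\<And>\<phi>. 0 \<le> \<phi> \<Longrightarrow> \<phi> \<le> pi / 2 \<Longrightarrow> dw_profile b \<phi> \<le> dw_profile b (arctan t\<^sub>0)"
proof -
  \<comment> \<open>The negative constant term of the cubic forces the root to be positive.\<close>
  have "t\<^sub>0 * Q 0 = 3 / (2 * b)" using fact[of 0] by simp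
  then have "0 < t\<^sub>0 * Q 0" using b by simp
  then show t0: "0 \<le> t\<^sub>0" using Q[of 0] by (simp add: zero_less_mult_iff)
  fix \<phi> :: real assume phi: "0 \<le> \<phi>" "\<phi> \<le> pi / 2"
  define \<theta> where "\<theta> = arctan t\<^sub>0"
  have th: "0 \<le> \<theta>" "\<theta> < pi / 2" "tan \<theta> = t\<^sub>0"
    using t0 arctan_ubound[of t\<^sub>0] by (simp_all add: \<theta>_def arctan)
  let ?f = "\<lambda>\<theta>. (dw_profile b \<theta>)\<^sup>2"
  let ?g = "\<lambda>x. - 4 * b\<^sup>2 * (cos x + b * sin x) * cos x ^ 3 * ((tan x - t\<^sub>0) * Q (tan x))"
  have cont: "continuous_on A ?f" for A
    unfolding dw_profile_def by (intro continuous_intros)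
  have pos: "0 < cos x" "0 < sin x" if "0 < x" "x < pi / 2" for x
    using that by (auto intro!: cos_gt_zero sin_gt_zero)
  have deriv: "(?f has_real_derivative ?g x) (at x)" if "0 < x" "x < pi / 2" for x
    using dw_profile_sq_deriv[of b x] pos[OF that] b unfolding fact by simp
  have g: "?g x = (4 * b\<^sup>2 * (cos x + b * sin x) * cos x ^ 3 * Q (tan x)) * (t\<^sub>0 - tan x)" for x
    by (simp add: algebra_simps)
  have coeff: "0 \<le> 4 * b\<^sup>2 * (cos x + b * sin x) * cos x ^ 3 * Q (tan x)"
    if "0 < x" "x < pi / 2" for x
    using pos[OF that] b Q[of "tan x"] by simp
  have "?f \<phi> \<le> ?f \<theta>"
  proof (cases \<phi> \<theta> rule: linorder_cases)
    case less
    show ?thesis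
    proof (rule DERIV_nonneg_imp_increasing_open[where f = ?f])
      fix x assume x: "\<phi> < x" "x < \<theta>"
      then have x': "0 < x" "x < pi / 2" using phi th by auto
      have "tan x \<le> t\<^sub>0" using tan_monotone[of x \<theta>] x x' th by simp
      then have "0 \<le> ?g x" unfolding g using coeff[OF x'] by simp
      then show "\<exists>y. (?f has_real_derivative y) (at x) \<and> 0 \<le> y"
        using deriv[OF x'] by blast
    qed (use less cont in auto)
  next
    case greater
    \<comment> \<open>The derivative is needed only strictly between the end points; continuity
      covers \<open>\<phi> = pi / 2\<close>, where the tangent has a pole.\<close>
    show ?thesis
    proof (rule DERIV_nonpos_imp_decreasing_open[where f = ?f])
      fix x assume x: "\<theta> < x" "x < \<phi>"
      then have x': "0 < x" "x < pi / 2" using phi th by auto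
      have "t\<^sub>0 \<le> tan x" using tan_monotone[of \<theta> x] x x' th by simp
      then have "?g x \<le> 0" unfolding g using coeff[OF x'] by (intro mult_nonneg_nonpos) auto
      then show "\<exists>y. (?f has_real_derivative y) (at x) \<and> y \<le> 0"
        using deriv[OF x'] by blast
    qed (use greater cont in auto)
  qed simp
  moreover have "0 \<le> dw_profile b \<theta>"
    unfolding dw_profile_def using th b by (simp add: cos_ge_zero sin_ge_zero)
  ultimately show "dw_profile b \<phi> \<le> dw_profile b (arctan t\<^sub>0)"
    unfolding \<theta>_def[symmetric] by (rule power2_le_imp_le)
qed

text \<open>Identifies the closed form of \<open>s\<close> with the radicand in Cardano's formula.
  The closed form has only positive coefficients and even powers of \<open>b\<close>, which makes
  its sign evident.\<close>

lemma dw_cubic_discriminant: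
  fixes b :: real
  assumes "b \<noteq> 0"
    and "p = - ((2 * b\<^sup>2 - 5) / (2 * b))" and "q = - ((2 * b\<^sup>2 - 2) / b\<^sup>2)"
    and "r = - (3 / (2 * b))"
  shows "1 / (2 ^ 4 * 3 ^ 3 * b ^ 6) * (8 * b ^ 8 + 20 * b ^ 6 + 45 * b ^ 4 + 61 * b\<^sup>2 + 28)
    = ((2 * p ^ 3 - 9 * p * q + 27 * r) / 27)\<^sup>2 / 4 + (q - p\<^sup>2 / 3) ^ 3 / 27"
proof -
  define x where "x = b\<^sup>2"
  \<comment> \<open>\<open>N\<close> and \<open>- M\<close> are the numerators of
    \<open>\<alpha>\<close> over \<open>108 b^3\<close> and of \<open>q - p^2 / 3\<close> over
    \<open>12 x\<close>. Both terms of the radicand then have the denominator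
    \<open>46656 x^3\<close>, because \<open>46656 = 4 * 108^2 = 27 * 12^3\<close>.\<close>
  define M N where "M = 24 * x - 24 + (5 - 2 * x)\<^sup>2"
    and "N = (5 - 2 * x) ^ 3 + 18 * (5 - 2 * x) * (2 * x - 2) - 162 * x"
  have "(2 * p ^ 3 - 9 * p * q + 27 * r) / 27 = N / (108 * b ^ 3)"
    using assms(1) unfolding assms(2-) N_def x_def
    by (simp add: field_simps power2_eq_square power3_eq_cube)
  moreover have "(b ^ 3)\<^sup>2 = x ^ 3"
    by (simp add: x_def flip: power_mult)
  ultimately have 1: "((2 * p ^ 3 - 9 * p * q + 27 * r) / 27)\<^sup>2 / 4 = N\<^sup>2 / (46656 * x ^ 3)"
    by (simp add: power_divide power_mult_distrib)
  have "q - p\<^sup>2 / 3 = (- M) / (12 * x)"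
    using assms(1) unfolding assms(2-) M_def x_def
    by (simp add: field_simps power2_eq_square)
  then have 2: "(q - p\<^sup>2 / 3) ^ 3 / 27 = - (M ^ 3) / (46656 * x ^ 3)"
    by (simp add: power_divide power_mult_distrib)
  have "N\<^sup>2 - M ^ 3 = 108 * (8 * x ^ 4 + 20 * x ^ 3 + 45 * x\<^sup>2 + 61 * x + 28)"
    unfolding M_def N_def by algebra
  then have "N\<^sup>2 / (46656 * x ^ 3) + - (M ^ 3) / (46656 * x ^ 3)
      = 108 * (8 * x ^ 4 + 20 * x ^ 3 + 45 * x\<^sup>2 + 61 * x + 28) / (46656 * x ^ 3)"
    by (metis add_divide_distrib add_uminus_conv_diff)
  also have "\<dots> = 1 / (2 ^ 4 * 3 ^ 3 * x ^ 3) *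
      (8 * x ^ 4 + 20 * x ^ 3 + 45 * x\<^sup>2 + 61 * x + 28)"
    unfolding mult.commute[of 108] by (simp del: distrib_left_numeral distrib_right_numeral)
  also have "\<dots> = 1 / (2 ^ 4 * 3 ^ 3 * b ^ 6) *
      (8 * b ^ 8 + 20 * b ^ 6 + 45 * b ^ 4 + 61 * b\<^sup>2 + 28)"
    by (simp add: x_def flip: power_mult)
  finally show ?thesis
    unfolding 1 2 by simp
qed

section \<open>The closed formula, for zero and for nonzero \<open>B\<close>\<close>

theorem theorem3p5:
  fixes B :: "'a::chilbert_space \<Rightarrow> 'a" and T :: "'a \<times> 'a \<Rightarrow> 'a \<times> 'a"
  assumes nontrivial: "(UNIV :: 'a set) \<noteq> {0}"
    and B: "bounded_clinear B"
    and T: "T = op_matrix (\<lambda>x. x) B (\<lambda>x. 0) (\<lambda>x. 0)"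
  shows "(B = (\<lambda>x. 0) \<longrightarrow> dw T = sqrt 2) \<and>
    (B \<noteq> (\<lambda>x. 0) \<longrightarrow>
      (let b = onorm B;
           p = - ((2 * b ^ 2 - 5) / (2 * b));
           q = - ((2 * b ^ 2 - 2) / b ^ 2);
           r = - (3 / (2 * b));
           s = 1 / (2 ^ 4 * 3 ^ 3 * b ^ 6) *
                 (8 * b ^ 8 + 20 * b ^ 6 + 45 * b ^ 4 + 61 * b ^ 2 + 28);
           \<alpha> = 1 / 27 * (2 * p ^ 3 - 9 * p * q + 27 * r);
           \<beta> = root 3 (- \<alpha> / 2 + sqrt s);
           \<gamma> = root 3 (- \<alpha> / 2 - sqrt s);
           \<theta>\<^sub>0 = arctan (\<beta> + \<gamma> - p / 3)
       in dw T = (cos \<theta>\<^sub>0 + b * sin \<theta>\<^sub>0) *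
                 sqrt ((cos \<theta>\<^sub>0) ^ 2 + (cos \<theta>\<^sub>0 + b * sin \<theta>\<^sub>0) ^ 2)))"
proof (intro conjI impI)
  assume B0: "B = (\<lambda>x. 0)"
  then have b0: "onorm B = 0" by (simp add: onorm_zero)
  \<comment> \<open>For \<open>b = 0\<close> the profile on this interval is \<open>sqrt 2\<close>
    times the squared cosine, which is largest at the angle zero.\<close>
  have le: "dw_profile (onorm B) \<phi> \<le> dw_profile (onorm B) 0" if "0 \<le> \<phi>" "\<phi> \<le> pi / 2" for \<phi>
  proof -
    have "0 \<le> cos \<phi>" using that by (intro cos_ge_zero) auto
    then have "cos \<phi> * sqrt ((cos \<phi>)\<^sup>2 + (cos \<phi>)\<^sup>2) \<le> 1 * sqrt (1\<^sup>2 + 1\<^sup>2)"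
      by (intro mult_mono real_sqrt_le_mono add_mono power_mono) auto
    then show ?thesis by (simp add: dw_profile_def b0)
  qed
  show "dw T = sqrt 2"
    using dw_op_matrix_eq[OF nontrivial B _ _ le] by (simp add: T dw_profile_def b0)
next
  assume B0: "B \<noteq> (\<lambda>x. 0)"
  have bl: "bounded_linear B" using B by (simp add: bounded_clinear_def)
  define b where "b = onorm B"
  have b: "0 < b"
    using B0 onorm_pos_lt[OF bl] by (auto simp: b_def)
  define p where "p = - ((2 * b ^ 2 - 5) / (2 * b))"
  define q where "q = - ((2 * b ^ 2 - 2) / b ^ 2)"
  define r where "r = - (3 / (2 * b))"
  define s where "s = 1 / (2 ^ 4 * 3 ^ 3 * b ^ 6) *
    (8 * b ^ 8 + 20 * b ^ 6 + 45 * b ^ 4 + 61 * b ^ 2 + 28)"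
  define \<alpha> where "\<alpha> = 1 / 27 * (2 * p ^ 3 - 9 * p * q + 27 * r)"
  define t\<^sub>0 where "t\<^sub>0 = root 3 (- \<alpha> / 2 + sqrt s) + root 3 (- \<alpha> / 2 - sqrt s) - p / 3"
  have \<alpha>: "\<alpha> = (2 * p ^ 3 - 9 * p * q + 27 * r) / 27" by (simp add: \<alpha>_def)
  have s: "s = \<alpha>\<^sup>2 / 4 + (q - p\<^sup>2 / 3) ^ 3 / 27"
    unfolding s_def \<alpha> using b by (intro dw_cubic_discriminant p_def q_def r_def) simp
  \<comment> \<open>Nonnegativity of \<open>s\<close> makes \<open>sqrt s\<close> a genuine square
    root, so that Cardano's formula applies with real cube roots.\<close>
  have "0 \<le> s" unfolding s_def using b by simp
  then obtain Q where Q: "\<And>t. 0 \<le> Q t"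
      and fact: "\<And>t. t ^ 3 + p * t\<^sup>2 + q * t + r = (t - t\<^sub>0) * Q t"
    using cardano_factorization[of s p q r] s unfolding t\<^sub>0_def \<alpha> by blast
  note max = dw_profile_max[OF b Q fact[unfolded p_def q_def r_def]]
  have "dw T = dw_profile b (arctan t\<^sub>0)"
    unfolding T b_def
    by (rule dw_op_matrix_eq[OF nontrivial B])
      (use max arctan_ubound[of t\<^sub>0] in \<open>auto simp: b_def intro: less_imp_le\<close>)
  then show "let b = onorm B;
           p = - ((2 * b ^ 2 - 5) / (2 * b));
           q = - ((2 * b ^ 2 - 2) / b ^ 2);
           r = - (3 / (2 * b));
           s = 1 / (2 ^ 4 * 3 ^ 3 * b ^ 6) *
                 (8 * b ^ 8 + 20 * b ^ 6 + 45 * b ^ 4 + 61 * b ^ 2 + 28);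
           \<alpha> = 1 / 27 * (2 * p ^ 3 - 9 * p * q + 27 * r);
           \<beta> = root 3 (- \<alpha> / 2 + sqrt s);
           \<gamma> = root 3 (- \<alpha> / 2 - sqrt s);
           \<theta>\<^sub>0 = arctan (\<beta> + \<gamma> - p / 3)
       in dw T = (cos \<theta>\<^sub>0 + b * sin \<theta>\<^sub>0) *
                 sqrt ((cos \<theta>\<^sub>0) ^ 2 + (cos \<theta>\<^sub>0 + b * sin \<theta>\<^sub>0) ^ 2)"
    unfolding Let_def b_def[symmetric] p_def[symmetric] q_def[symmetric] r_def[symmetric]
      s_def[symmetric] \<alpha>_def[symmetric] t\<^sub>0_def[symmetric] dw_profile_def .
qed

end
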